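(* Let $H_1,H_2:\mathbb{R}^n\to\mathbb{R}$ be continuous functions and assume that $H_1(0)=H_2(0)=0$. Let $B_1,B_2:\mathbb{R}^2\to\mathbb{R}$ be the functions defined in the context. For any $\lambda>0$, let $(u_{\lambda,1},u_{\lambda,2})$ be the (unique) viscosity solution of the system $$\begin{cases}\lambda u_1(x)+H_1(Du_1(x))+B_1(u_1(x),u_2(x))=0 & \text{in } \mathbb{T}^n,\\ \lambda u_2(x)+H_2(Du_2(x))+B_2(u_1(x),u_2(x))=0 & \text{in } \mathbb{T}^n.\end{cases}$$ Then the functions $u_{\lambda,i}$ ($i=1,2$) are constants, the family of the points $(u_{\lambda,1},u_{\lambda,2})$, $\lambda>0$, in $\mathbb{R}^2$ is bounded, and it does not converge as $\lambda\to0+$.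
   Context: $\mathbb{T}^n=\mathbb{R}^n/\mathbb{Z}^n$ is the $n$-dimensional torus. Fix a real number $d>1$, set $\gamma=\frac{d}{1+d}$, and choose $K\in\mathbb{N}$ (a positive integer) such that $\gamma+4^{-K}<1$. Let $$\mathcal{A}=\{\gamma+4^{-k} : k\in\mathbb{N},\ k\ge K\}\cup\{\gamma\},\qquad \mathcal{B}=\{0,1\}.$$ For $\alpha,\beta\in\mathbb{R}$ set $$c_{11}(\alpha,\beta)=c_{22}(\alpha,\beta)=\alpha+\beta-2\alpha\beta,\qquad c_{12}(\alpha,\beta)=c_{21}(\alpha,\beta)=-(\alpha+\beta-2\alpha\beta),$$ $$L_1(\alpha,\beta)=\alpha\beta+d^2(1-\alpha)(1-\beta),\qquad L_2(\alpha,\beta)=-\alpha\beta-d^2(1-\alpha)(1-\beta).$$ For $i\in\{1,2\}$ the continuous function $B_i:\mathbb{R}^2\to\mathbb{R}$ is $$B_i(u_1,u_2)=\max_{\alpha\in\mathcal{A}}\ \min_{\beta\in\mathcal{B}}\bigl(c_{i1}(\alpha,\beta)u_1+c_{i2}(\alpha,\beta)u_2-L_i(\alpha,\beta)\bigr).$$ A viscosity solution of the system is a pair $(u_1,u_2)\in C(\mathbb{T}^n)^2$ such that, for each $i\in\{1,2\}$, whenever $\varphi\in C^1(\mathbb{T}^n)$ and $u_i-\varphi$ attains a maximum (resp. minimum) at $\hat x\in\mathbb{T}^n$, one has $\lambda u_i(\hat x)+H_i(D\varphi(\hat x))+B_i(u_1(\hat x),u_2(\hat x))\le 0$ (resp.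 $\ge0$). For every $\lambda>0$ the system has a unique viscosity solution. *)

theory Defs
  imports "HOL-Analysis.Analysis"
begin

text \<open>
  Functions on the torus \<open>\<real>\<^sup>n / \<int>\<^sup>n\<close> are represented by \<open>\<int>\<^sup>n\<close>-periodic functions on \<open>\<real>\<^sup>n\<close>.
  Under this identification \<open>C(\<T>\<^sup>n)\<close> consists of the continuous periodic functions, and
  \<open>C\<^sup>1(\<T>\<^sup>n)\<close> of the periodic functions with a continuous gradient.
\<close>

definition periodic :: "(real ^ 'n \<Rightarrow> 'b) \<Rightarrow> bool" where
  "periodic f \<longleftrightarrow> (\<forall>x z. (\<forall>j. z $ j \<in> \<int>) \<longrightarrow> f (x + z) = f x)"

definition C1_torus :: "(real ^ 'n \<Rightarrow> real) \<Rightarrow> (real ^ 'n \<Rightarrow> real ^ 'n) \<Rightarrow> bool" where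
  "C1_torus \<phi> D\<phi> \<longleftrightarrow>
     periodic \<phi> \<and> (\<forall>x. GDERIV \<phi> x :> D\<phi> x) \<and> continuous_on UNIV D\<phi>"

text \<open>
  The two components are indexed by the type \<open>2\<close>, whose elements are \<open>1\<close> and \<open>2\<close> (and \<open>2 = 0\<close>).
\<close>

definition viscosity_solution ::
    "real \<Rightarrow> (2 \<Rightarrow> real ^ 'n \<Rightarrow> real) \<Rightarrow> (2 \<Rightarrow> real ^ 2 \<Rightarrow> real) \<Rightarrow> (real ^ 'n \<Rightarrow> real ^ 2) \<Rightarrow> bool"
  where
  "viscosity_solution lam H B u \<longleftrightarrow>
     periodic u \<and> continuous_on UNIV u \<and>
     (\<forall>i \<phi> D\<phi> x. C1_torus \<phi> D\<phi> \<longrightarrow>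
        ((\<forall>y. u y $ i - \<phi> y \<le> u x $ i - \<phi> x) \<longrightarrow>
           lam * u x $ i + H i (D\<phi> x) + B i (u x) \<le> 0) \<and>
        ((\<forall>y. u y $ i - \<phi> y \<ge> u x $ i - \<phi> x) \<longrightarrow>
           lam * u x $ i + H i (D\<phi> x) + B i (u x) \<ge> 0))"

definition gam :: "real \<Rightarrow> real" where
  "gam d = d / (1 + d)"

definition controls_A :: "real \<Rightarrow> nat \<Rightarrow> real set" where
  "controls_A d K = {gam d + (1 / 4) ^ k | k. k \<ge> K} \<union> {gam d}"

definition controls_B :: "real set" where
  "controls_B = {0, 1}"

definition c :: "2 \<Rightarrow> 2 \<Rightarrow> real \<Rightarrow> real \<Rightarrow> real" where
  "c i j \<alpha> \<beta> =
     (if i = j then \<alpha> + \<beta> - 2 * \<alpha> * \<beta> else - (\<alpha> + \<beta> - 2 * \<alpha> * \<beta>))"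

definition L :: "real \<Rightarrow> 2 \<Rightarrow> real \<Rightarrow> real \<Rightarrow> real" where
  "L d i \<alpha> \<beta> =
     (if i = 1 then \<alpha> * \<beta> + d\<^sup>2 * (1 - \<alpha>) * (1 - \<beta>)
      else - \<alpha> * \<beta> - d\<^sup>2 * (1 - \<alpha>) * (1 - \<beta>))"

definition payoff :: "real \<Rightarrow> 2 \<Rightarrow> real ^ 2 \<Rightarrow> real \<Rightarrow> real \<Rightarrow> real" where
  "payoff d i u \<alpha> \<beta> = c i 1 \<alpha> \<beta> * u $ 1 + c i 2 \<alpha> \<beta> * u $ 2 - L d i \<alpha> \<beta>"

text \<open>The supremum is a maximum; see \<open>coupling_attained\<close> below.\<close>

definition coupling :: "real \<Rightarrow> nat \<Rightarrow> 2 \<Rightarrow> real ^ 2 \<Rightarrow> real" where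
  "coupling d K i u = (SUP \<alpha>\<in>controls_A d K. Min (payoff d i u \<alpha> ` controls_B))"

lemma compact_controls_A: "compact (controls_A d K)"
proof -
  have "(\<lambda>k. (1 / 4 :: real) ^ (k + K)) \<longlonglongrightarrow> 0"
    by (rule LIMSEQ_ignore_initial_segment) (simp add: LIMSEQ_power_zero)
  then have "(\<lambda>k. gam d + (1 / 4) ^ (k + K)) \<longlonglongrightarrow> gam d + 0"
    by (intro tendsto_intros)
  then have "compact (insert (gam d) (range (\<lambda>k. gam d + (1 / 4) ^ (k + K))))"
    by (intro compact_sequence_with_limit) simp
  also have "insert (gam d) (range (\<lambda>k. gam d + (1 / 4) ^ (k + K))) = controls_A d K"
    unfolding controls_A_def by (auto simp: image_iff) (metis le_add_diff_inverse2)
  finally show ?thesis .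
qed

lemma coupling_attained:
  shows "\<exists>\<alpha>\<in>controls_A d K. coupling d K i u = Min (payoff d i u \<alpha> ` controls_B)"
    and "\<forall>\<alpha>\<in>controls_A d K. Min (payoff d i u \<alpha> ` controls_B) \<le> coupling d K i u"
proof -
  let ?f = "\<lambda>\<alpha>. Min (payoff d i u \<alpha> ` controls_B)"
  have f: "?f = (\<lambda>\<alpha>. min (payoff d i u \<alpha> 0) (payoff d i u \<alpha> 1))"
    by (simp add: controls_B_def)
  have "continuous_on (controls_A d K) ?f"
    unfolding f payoff_def c_def L_def
    by (cases "i = 1"; cases "i = 2"; simp; intro continuous_intros)
  then obtain a where a: "a \<in> controls_A d K" "\<forall>\<alpha>\<in>controls_A d K. ?f \<alpha> \<le> ?f a"
    using continuous_attains_sup[OF compact_controls_A, of d K ?f]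
    by (auto simp: controls_A_def)
  have "coupling d K i u = ?f a"
    unfolding coupling_def using a by (intro cSup_eq_maximum) auto
  with a show "\<exists>\<alpha>\<in>controls_A d K. coupling d K i u = ?f \<alpha>"
    and "\<forall>\<alpha>\<in>controls_A d K. ?f \<alpha> \<le> coupling d K i u"
    by auto
qed

end

theory Submission
  imports Defs
begin

text \<open>
  Testing with constants at the extrema of \<open>u\<^sub>i\<close> and using that the coupling is monotone and
  depends only on the gap \<open>s = u\<^sub>1 - u\<^sub>2\<close>, one sees that the solution is constant. The gap of the
  constant solution solves \<open>\<lambda> s = F\<^sub>2 s - F\<^sub>1 s\<close>, where \<open>F\<^sub>1\<close> is nondecreasing and
  \<open>F\<^sub>2\<close> nonincreasing, both vanishing at \<open>d\<close>; hence every gap \<open>d - r\<close> with small \<open>r > 0\<close> occurs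
  for exactly one \<open>\<lambda>\<close>, which is of order \<open>r\<close>.

  At gap \<open>d - r\<close> and control \<open>\<gamma> + x\<close> the payoffs are \<open>\<plusminus>P x\<close> and \<open>\<plusminus>Q x\<close>, with \<open>P\<close> decreasing and
  \<open>Q\<close> increasing, and the two lines meet at some \<open>g\<close> of order \<open>r\<close>. If \<open>g\<close> is one of the
  available offsets \<open>4\<^sup>-\<^sup>k\<close>, the game has a saddle point, \<open>F\<^sub>1 + F\<^sub>2 = 0\<close> and \<open>u\<^sub>1 + u\<^sub>2 = 0\<close>. If \<open>g\<close>
  is half of such an offset, there is a duality gap proportional to \<open>r\<close>, so \<open>u\<^sub>1 + u\<^sub>2\<close>
  stays away from \<open>0\<close>. Both cases occur for arbitrarily small \<open>\<lambda>\<close>.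
\<close>

section \<open>Extrema of periodic functions\<close>

lemma periodic_attains_sup:
  fixes f :: "real ^ 'n \<Rightarrow> real"
  assumes "periodic f" and "continuous_on UNIV f"
  obtains x where "\<And>y. f y \<le> f x"
proof -
  let ?C = "cbox 0 (\<chi> i. 1) :: (real ^ 'n) set"
  have "continuous_on ?C f"
    using assms(2) by (rule continuous_on_subset) simp
  moreover have "0 \<in> ?C"
    by (simp add: mem_box_cart)
  ultimately obtain x where x: "\<forall>y\<in>?C. f y \<le> f x"
    using continuous_attains_sup[of ?C f] by auto
  have "f y \<le> f x" for y
  proof -
    \<comment> \<open>Subtracting integer parts moves any point into the compact unit cube, where
      the maximum was taken.\<close>
    let ?p = "\<chi> i. frac (y $ i)" and ?z = "\<chi> i. real_of_int \<lfloor>y $ i\<rfloor>"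
    have "y = ?p + ?z"
      by (simp add: vec_eq_iff frac_def)
    then have "f y = f ?p"
      using assms(1) unfolding periodic_def by (metis Ints_of_int vec_lambda_beta)
    moreover have "?p \<in> ?C"
      by (auto simp: mem_box_cart less_imp_le[OF frac_lt_1])
    ultimately show ?thesis
      using x by simp
  qed
  then show thesis by (rule that)
qed

lemma periodic_attains_inf:
  fixes f :: "real ^ 'n \<Rightarrow> real"
  assumes "periodic f" and "continuous_on UNIV f"
  obtains x where "\<And>y. f x \<le> f y"
proof -
  have "periodic (\<lambda>x. - f x)" "continuous_on UNIV (\<lambda>x. - f x)"
    using assms by (simp_all add: periodic_def continuous_on_minus)
  then obtain x where "\<And>y. - f y \<le> - f x"
    using periodic_attains_sup by blast
  then show thesis
    by (intro that[of x]) simp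
qed

section \<open>Reduction of the couplings to functions of the gap\<close>

definition gap_coupling :: "real \<Rightarrow> nat \<Rightarrow> 2 \<Rightarrow> real \<Rightarrow> real" where
  "gap_coupling d K i s = coupling d K i (vector [s, 0])"

lemma payoff_simps:
  "payoff d 1 u \<alpha> 0 = \<alpha> * (u $ 1 - u $ 2) - d\<^sup>2 * (1 - \<alpha>)"
  "payoff d 1 u \<alpha> 1 = (1 - \<alpha>) * (u $ 1 - u $ 2) - \<alpha>"
  "payoff d 2 u \<alpha> 0 = d\<^sup>2 * (1 - \<alpha>) - \<alpha> * (u $ 1 - u $ 2)"
  "payoff d 2 u \<alpha> 1 = \<alpha> - (1 - \<alpha>) * (u $ 1 - u $ 2)"
  by (simp_all add: payoff_def c_def L_def algebra_simps)

text \<open>The coefficients satisfy \<open>c i 1 = - c i 2\<close>, so every payoff sees only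
  \<open>u $ 1 - u $ 2\<close>; the vector \<open>[s, 0]\<close> is one representative of the gap
  s.\<close>

lemma coupling_eq_gap_coupling: "coupling d K i u = gap_coupling d K i (u $ 1 - u $ 2)"
proof -
  have "payoff d i u \<alpha> \<beta> = payoff d i (vector [u $ 1 - u $ 2, 0]) \<alpha> \<beta>" for \<alpha> \<beta>
    using exhaust_2[of i] by (auto simp: payoff_def c_def algebra_simps)
  then show ?thesis
    by (simp add: gap_coupling_def coupling_def)
qed

lemma gap_coupling_leI:
  assumes "\<And>\<alpha>. \<alpha> \<in> controls_A d K \<Longrightarrow>
    payoff d i (vector [s, 0]) \<alpha> 0 \<le> b \<or> payoff d i (vector [s, 0]) \<alpha> 1 \<le> b"
  shows "gap_coupling d K i s \<le> b"
  using coupling_attained(1)[of d K i "vector [s, 0]"] assms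
  by (auto simp: gap_coupling_def controls_B_def min_le_iff_disj)

lemma gap_coupling_geI:
  assumes "\<alpha> \<in> controls_A d K"
    and "b \<le> payoff d i (vector [s, 0]) \<alpha> 0" and "b \<le> payoff d i (vector [s, 0]) \<alpha> 1"
  shows "b \<le> gap_coupling d K i s"
  using coupling_attained(2)[of d K i "vector [s, 0]"] assms
  by (force simp: gap_coupling_def controls_B_def)

section \<open>Monotonicity of the couplings in the gap\<close>

locale game =
  fixes d :: real and K :: nat
  assumes d_gt_1: "d > 1" and K_large: "gam d + (1 / 4) ^ K < 1"
begin

abbreviation "\<gamma> \<equiv> gam d"
abbreviation "F1 \<equiv> gap_coupling d K 1"
abbreviation "F2 \<equiv> gap_coupling d K 2"

lemma gam_mult: "(1 + d) * \<gamma> = d"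
  using d_gt_1 by (simp add: gam_def)

lemma gam_bounds: "1 / 2 < \<gamma>" "\<gamma> < 1"
  using d_gt_1 by (simp_all add: gam_def field_simps)

lemma controls_bounds:
  assumes "\<alpha> \<in> controls_A d K"
  shows "\<gamma> \<le> \<alpha>" "\<alpha> < 1"
proof -
  show "\<gamma> \<le> \<alpha>"
    using assms by (auto simp: controls_A_def)
  have "\<gamma> + (1 / 4) ^ k < 1" if "k \<ge> K" for k
  proof -
    have "(1 / 4 :: real) ^ k \<le> (1 / 4) ^ K"
      using that by (rule power_decreasing) simp_all
    with K_large show ?thesis by linarith
  qed
  then show "\<alpha> < 1"
    using assms gam_bounds by (auto simp: controls_A_def)
qed

text \<open>Controls lie in [0, 1], so the weights \<alpha> and 1 - \<alpha> of the gap are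
  nonnegative. A control that is optimal at s therefore does at least as well at t.\<close>

lemma F1_mono:
  assumes "s \<le> t"
  shows "F1 s \<le> F1 t"
proof -
  obtain \<alpha> where \<alpha>: "\<alpha> \<in> controls_A d K"
    and F: "F1 s = Min (payoff d 1 (vector [s, 0]) \<alpha> ` controls_B)"
    using coupling_attained(1) unfolding gap_coupling_def by blast
  have "\<alpha> * s \<le> \<alpha> * t" "(1 - \<alpha>) * s \<le> (1 - \<alpha>) * t"
    using assms controls_bounds[OF \<alpha>] gam_bounds by (auto intro: mult_left_mono)
  then show ?thesis
    unfolding F by (intro gap_coupling_geI[OF \<alpha>]) (auto simp: controls_B_def payoff_simps min_le_iff_disj)
qed

lemma F2_antimono:
  assumes "s \<le> t"
  shows "F2 t \<le> F2 s"
proof -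
  obtain \<alpha> where \<alpha>: "\<alpha> \<in> controls_A d K"
    and F: "F2 t = Min (payoff d 2 (vector [t, 0]) \<alpha> ` controls_B)"
    using coupling_attained(1) unfolding gap_coupling_def by blast
  have "\<alpha> * s \<le> \<alpha> * t" "(1 - \<alpha>) * s \<le> (1 - \<alpha>) * t"
    using assms controls_bounds[OF \<alpha>] gam_bounds by (auto intro: mult_left_mono)
  then show ?thesis
    unfolding F by (intro gap_coupling_geI[OF \<alpha>]) (auto simp: controls_B_def payoff_simps min_le_iff_disj)
qed

section \<open>Payoffs at gaps slightly below d\<close>

definition "P r x = \<gamma> * r - (d * (1 + d) - r) * x"
definition "Q r x = (1 - \<gamma>) * r + (1 + d - r) * x"

text \<open>At gap d and control \<gamma> all four payoffs vanish, since (1 + d) \<gamma> = d. What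
  remains is affine in r and in x, with a mixed term r x.\<close>

lemma payoff_offset:
  "payoff d 1 (vector [d - r, 0]) (\<gamma> + x) 0 = - P r x"
  "payoff d 1 (vector [d - r, 0]) (\<gamma> + x) 1 = - Q r x"
  "payoff d 2 (vector [d - r, 0]) (\<gamma> + x) 0 = P r x"
  "payoff d 2 (vector [d - r, 0]) (\<gamma> + x) 1 = Q r x"
proof -
  have eqs: "\<gamma> + d * \<gamma> = d" "d * \<gamma> + d * (d * \<gamma>) = d * d"
    using gam_mult by (simp_all add: algebra_simps flip: distrib_left)
  show
    "payoff d 1 (vector [d - r, 0]) (\<gamma> + x) 0 = - P r x"
    "payoff d 1 (vector [d - r, 0]) (\<gamma> + x) 1 = - Q r x"
    "payoff d 2 (vector [d - r, 0]) (\<gamma> + x) 0 = P r x"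
    "payoff d 2 (vector [d - r, 0]) (\<gamma> + x) 1 = Q r x"
    using eqs by (simp_all add: payoff_simps P_def Q_def algebra_simps power2_eq_square)
qed

definition offsets :: "real set" where
  "offsets = insert 0 {(1 / 4) ^ k | k. k \<ge> K}"

lemma controls_A_offsets: "controls_A d K = (\<lambda>x. \<gamma> + x) ` offsets"
  by (auto simp: controls_A_def offsets_def)

lemma offsets_nonneg: "x \<in> offsets \<Longrightarrow> 0 \<le> x"
  by (auto simp: offsets_def)

lemma F1_leI:
  assumes "\<And>x. x \<in> offsets \<Longrightarrow> - P r x \<le> b \<or> - Q r x \<le> b"
  shows "F1 (d - r) \<le> b"
  by (rule gap_coupling_leI)
    (unfold controls_A_offsets, elim imageE, simp only: payoff_offset assms)

lemma F2_leI:
  assumes "\<And>x. x \<in> offsets \<Longrightarrow> P r x \<le> b \<or> Q r x \<le> b"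
  shows "F2 (d - r) \<le> b"
  by (rule gap_coupling_leI)
    (unfold controls_A_offsets, elim imageE, simp only: payoff_offset assms)

lemma F1_geI:
  assumes "x \<in> offsets" "b \<le> - P r x" "b \<le> - Q r x"
  shows "b \<le> F1 (d - r)"
  using assms by (intro gap_coupling_geI[of "\<gamma> + x"]) (auto simp: controls_A_offsets payoff_offset)

lemma F2_geI:
  assumes "x \<in> offsets" "b \<le> P r x" "b \<le> Q r x"
  shows "b \<le> F2 (d - r)"
  using assms by (intro gap_coupling_geI[of "\<gamma> + x"]) (auto simp: controls_A_offsets payoff_offset)

lemma slope_le: "1 + d - r \<le> d * (1 + d) - r"
  using mult_right_mono[of 1 d "1 + d"] d_gt_1 by simp

text \<open>Offset 0 has P = \<gamma> r and Q = (1 - \<gamma>) r, which gives the lower bounds. For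
  the upper bounds the reply \<beta> = 1 works against \<open>F1\<close> and \<beta> = 0 against
  \<open>F2\<close>, because over nonnegative offsets Q is smallest and P largest at 0.\<close>

lemma F_bounds:
  assumes "0 \<le> r" "r < 1"
  shows "- (\<gamma> * r) \<le> F1 (d - r)" "F1 (d - r) \<le> - ((1 - \<gamma>) * r)"
    "(1 - \<gamma>) * r \<le> F2 (d - r)" "F2 (d - r) \<le> \<gamma> * r"
proof -
  have m: "0 \<le> 1 + d - r" "0 \<le> d * (1 + d) - r"
    using assms d_gt_1 slope_le[of r] by linarith+
  have le: "(1 - \<gamma>) * r \<le> \<gamma> * r"
    using assms gam_bounds by (intro mult_right_mono) auto
  have P: "P r x \<le> \<gamma> * r" and Q: "(1 - \<gamma>) * r \<le> Q r x" if "x \<in> offsets" for x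
    using m offsets_nonneg[OF that] by (simp_all add: P_def Q_def)
  have 0: "0 \<in> offsets"
    by (simp add: offsets_def)
  show "- (\<gamma> * r) \<le> F1 (d - r)"
    by (rule F1_geI[OF 0]) (use le in \<open>simp_all add: P_def Q_def\<close>)
  show "(1 - \<gamma>) * r \<le> F2 (d - r)"
    by (rule F2_geI[OF 0]) (use le in \<open>simp_all add: P_def Q_def\<close>)
  show "F1 (d - r) \<le> - ((1 - \<gamma>) * r)"
    using Q by (intro F1_leI) simp
  show "F2 (d - r) \<le> \<gamma> * r"
    using P by (intro F2_leI) blast
qed

lemma F_at_d: "F1 d = 0" "F2 d = 0"
  using F_bounds[of 0] by auto

section \<open>Saddle points and duality gaps\<close>

definition balance :: "real \<Rightarrow> real" where
  "balance g = (1 + d)\<^sup>2 * g / (2 * \<gamma> - 1 + 2 * g)"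

text \<open>Solving \<open>P r g = Q r g\<close> for r gives (2 \<gamma> - 1 + 2 g) r = (1 + d)^2 g.
  Thus \<open>balance g\<close> is the deficit that makes the two lines cross at a prescribed g; the
  denominator is positive because \<gamma> > 1/2.\<close>

lemma P_eq_Q_balance:
  assumes "g \<ge> 0"
  shows "P (balance g) g = Q (balance g) g"
proof -
  have "balance g * (2 * \<gamma> - 1 + 2 * g) = (1 + d)\<^sup>2 * g"
    using assms gam_bounds by (simp add: balance_def)
  then show ?thesis
    unfolding P_def Q_def by algebra
qed

text \<open>\<open>F2\<close> is the max-min of P and Q over the offsets, and \<open>F1\<close> is
  minus their min-max. As P is nonincreasing and Q nondecreasing, both are attained at the crossing
  point g, with the same value.\<close>

lemma F_sum_saddle:
  assumes "g \<in> offsets" "balance g < 1"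
  shows "F1 (d - balance g) + F2 (d - balance g) = 0"
proof -
  let ?r = "balance g" and ?v = "P (balance g) g"
  have g: "g \<ge> 0"
    using assms(1) by (rule offsets_nonneg)
  have m: "0 \<le> 1 + d - ?r" "0 \<le> d * (1 + d) - ?r"
    using assms d_gt_1 slope_le[of ?r] by linarith+
  have v: "Q ?r g = ?v"
    using P_eq_Q_balance[OF g] by simp
  have mono: "P ?r y \<le> P ?r x" "Q ?r x \<le> Q ?r y" if "x \<le> y" for x y
    using m that by (auto simp: P_def Q_def intro: mult_left_mono)
  have "F1 (d - ?r) = - ?v"
  proof (rule antisym)
    show "F1 (d - ?r) \<le> - ?v"
    proof (rule F1_leI)
      show "- P ?r x \<le> - ?v \<or> - Q ?r x \<le> - ?v" for x
        using mono(1)[of x g] mono(2)[of g x] v by (cases "x \<le> g") auto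
    qed
  qed (use v in \<open>auto intro: F1_geI[OF assms(1)]\<close>)
  moreover have "F2 (d - ?r) = ?v"
  proof (rule antisym)
    show "F2 (d - ?r) \<le> ?v"
    proof (rule F2_leI)
      show "P ?r x \<le> ?v \<or> Q ?r x \<le> ?v" for x
        using mono(2)[of x g] mono(1)[of g x] v by (cases "x \<le> g") auto
    qed
  qed (use v in \<open>auto intro: F2_geI[OF assms(1)]\<close>)
  ultimately show ?thesis by simp
qed

text \<open>Both lines have slope at least d in size, and every offset is at distance at least g/2
  from the crossing point. So the max-min falls short of the crossing value by at least d g/2, and
  the min-max exceeds it by as much.\<close>

lemma F_sum_no_saddle:
  assumes g: "g \<ge> 0" and r: "balance g < 1"
    and sep: "\<And>x. x \<in> offsets \<Longrightarrow> x \<le> g / 2 \<or> 3 / 2 * g \<le> x"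
  shows "F1 (d - balance g) + F2 (d - balance g) \<le> - (d * g)"
proof -
  let ?r = "balance g" and ?v = "P (balance g) g"
  have m: "d \<le> 1 + d - ?r" "d \<le> d * (1 + d) - ?r"
    using r slope_le[of ?r] by linarith+
  have v: "Q ?r g = ?v"
    using P_eq_Q_balance[OF g] by simp
  have step: "d * (g / 2) \<le> (1 + d - ?r) * y" "d * (g / 2) \<le> (d * (1 + d) - ?r) * y"
    if "g / 2 \<le> y" for y
    using mult_mono[OF m(1) that] mult_mono[OF m(2) that] m g d_gt_1 by auto
  \<comment> \<open>Each line is expanded about g in two forms, so that on either side of g the
    bounds of \<open>step\<close> apply to a positive distance.\<close>
  have P: "P ?r x = ?v + (d * (1 + d) - ?r) * (g - x)" "P ?r x = ?v - (d * (1 + d) - ?r) * (x - g)" for x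
    by (simp_all add: P_def algebra_simps)
  have Q: "Q ?r x = ?v - (1 + d - ?r) * (g - x)" "Q ?r x = ?v + (1 + d - ?r) * (x - g)" for x
    unfolding v[symmetric] by (simp_all add: Q_def algebra_simps)
  have "F1 (d - ?r) \<le> - ?v - d * (g / 2)"
  proof (rule F1_leI)
    fix x assume "x \<in> offsets"
    then consider "x \<le> g / 2" | "3 / 2 * g \<le> x"
      using sep by blast
    then show "- P ?r x \<le> - ?v - d * (g / 2) \<or> - Q ?r x \<le> - ?v - d * (g / 2)"
      using step(2)[of "g - x"] step(1)[of "x - g"] P(1)[of x] Q(2)[of x] by cases auto
  qed
  moreover have "F2 (d - ?r) \<le> ?v - d * (g / 2)"
  proof (rule F2_leI)
    fix x assume "x \<in> offsets"
    then consider "x \<le> g / 2" | "3 / 2 * g \<le> x"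
      using sep by blast
    then show "P ?r x \<le> ?v - d * (g / 2) \<or> Q ?r x \<le> ?v - d * (g / 2)"
      using step(1)[of "g - x"] step(2)[of "x - g"] P(2)[of x] Q(1)[of x] by cases auto
  qed
  ultimately show ?thesis by simp
qed

text \<open>No power of 1/4 lies strictly between two consecutive ones. For g =
  \<open>(1 / 4) ^ k / 2\<close> this empty interval runs from g/2 to 2 g, which provides the
  separation required in \<open>F_sum_no_saddle\<close>.\<close>

lemma offsets_separated:
  assumes "x \<in> offsets"
  shows "x \<le> (1 / 4) ^ k / 4 \<or> (1 / 4) ^ k \<le> x"
proof -
  consider "x = 0" | j where "x = (1 / 4) ^ j"
    using assms by (auto simp: offsets_def)
  then show ?thesis
  proof cases
    case 2
    have "(1 / 4 :: real) ^ j \<le> (1 / 4) ^ Suc k \<or> (1 / 4 :: real) ^ k \<le> (1 / 4) ^ j"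
      by (cases "Suc k \<le> j") (auto intro!: power_decreasing disjI1 disjI2 simp del: power_Suc)
    with 2 show ?thesis by simp
  qed simp
qed

section \<open>Constant solutions and their gaps\<close>

definition lam_of_deficit :: "real \<Rightarrow> real" where
  "lam_of_deficit r = (F2 (d - r) - F1 (d - r)) / (d - r)"

text \<open>Subtracting the two equations for constants gives \<open>lam * s = F2 s - F1 s\<close>
  for the gap s; \<open>lam_of_deficit r\<close> is the value of \<open>lam\<close> that makes s = d
  - r a root. The bounds on \<open>F1\<close> and \<open>F2\<close> show that it is positive and at
  most of order r.\<close>

lemma lam_of_deficit_bounds:
  assumes "0 < r" "r < 1"
  shows "0 < lam_of_deficit r" "lam_of_deficit r \<le> 2 * \<gamma> * r / (d - r)"
proof -
  have "0 < (1 - \<gamma>) * r"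
    using assms gam_bounds by simp
  then have "0 < F2 (d - r) - F1 (d - r)" "F2 (d - r) - F1 (d - r) \<le> 2 * \<gamma> * r"
    using F_bounds[of r] assms by linarith+
  then show "0 < lam_of_deficit r" "lam_of_deficit r \<le> 2 * \<gamma> * r / (d - r)"
    using assms d_gt_1
    by (auto simp: lam_of_deficit_def intro!: divide_pos_pos divide_right_mono)
qed

definition constant_solution :: "real \<Rightarrow> real ^ 2 \<Rightarrow> bool" where
  "constant_solution lam w \<longleftrightarrow> (\<forall>i. lam * w $ i + coupling d K i w = 0)"

lemma constant_solution_iff:
  "constant_solution lam w \<longleftrightarrow>
    lam * w $ 1 = - F1 (w $ 1 - w $ 2) \<and> lam * w $ 2 = - F2 (w $ 1 - w $ 2)"
  by (auto simp: constant_solution_def forall_2 coupling_eq_gap_coupling[of d K _ w])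

text \<open>Beyond d, monotonicity and the zeros of \<open>F1\<close> and \<open>F2\<close> at d
  would force \<open>w $ 1\<close> \<le> 0 \<le> \<open>w $ 2\<close>, hence a nonpositive
  gap.\<close>

lemma constant_solution_gap_le:
  assumes "constant_solution lam w" "lam > 0"
  shows "w $ 1 - w $ 2 \<le> d"
proof (rule ccontr)
  assume *: "\<not> ?thesis"
  then have "lam * w $ 1 \<le> 0" "lam * w $ 2 \<ge> 0"
    using assms F1_mono[of d "w $ 1 - w $ 2"] F2_antimono[of d "w $ 1 - w $ 2"]
    by (auto simp: constant_solution_iff F_at_d)
  then have "w $ 1 \<le> 0" "w $ 2 \<ge> 0"
    using assms(2) by (auto simp: mult_le_0_iff zero_le_mult_iff)
  with * d_gt_1 show False by simp
qed

text \<open>With the gap at most d the signs are \<open>w $ 2\<close> \<le> 0 \<le>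
  \<open>w $ 1\<close>, so the gap itself is the sum of the absolute values.\<close>

lemma constant_solution_bounds:
  assumes "constant_solution lam w" "lam > 0"
  shows "norm w \<le> 2 * d"
proof -
  note le = constant_solution_gap_le[OF assms]
  have "lam * w $ 1 \<ge> 0" "lam * w $ 2 \<le> 0"
    using assms F1_mono[OF le] F2_antimono[OF le] by (auto simp: constant_solution_iff F_at_d)
  then have "w $ 1 \<ge> 0" "w $ 2 \<le> 0"
    using assms(2) by (auto simp: mult_le_0_iff zero_le_mult_iff)
  then have "\<bar>w $ 1\<bar> + \<bar>w $ 2\<bar> \<le> 2 * d"
    using le d_gt_1 by linarith
  then show ?thesis
    using norm_le_l1_cart[of w] by (simp add: sum_2)
qed

text \<open>The gap equation has only one root: \<open>lam * s\<close> is strictly increasing in s,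
  whereas \<open>F2 s - F1 s\<close> is nonincreasing.\<close>

lemma constant_solution_gap:
  assumes w: "constant_solution (lam_of_deficit r) w" and r: "0 < r" "r < 1"
  shows "w $ 1 - w $ 2 = d - r"
proof -
  define lam where "lam = lam_of_deficit r"
  have lam: "lam > 0"
    using lam_of_deficit_bounds(1)[OF r] by (simp add: lam_def)
  have 1: "lam * (d - r) = F2 (d - r) - F1 (d - r)"
    using r d_gt_1 by (simp add: lam_def lam_of_deficit_def)
  have 2: "lam * (w $ 1 - w $ 2) = F2 (w $ 1 - w $ 2) - F1 (w $ 1 - w $ 2)"
    using w by (simp add: constant_solution_iff lam_def algebra_simps)
  have "lam * s \<le> lam * t"
    if "lam * s = F2 s - F1 s" "lam * t = F2 t - F1 t" "t \<le> s" for s t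
    using F1_mono[OF that(3)] F2_antimono[OF that(3)] that by simp
  then have "s \<le> t" if "lam * s = F2 s - F1 s" "lam * t = F2 t - F1 t" for s t
    using lam that by (metis linear mult_le_cancel_left_pos)
  then show ?thesis
    using 1 2 by (blast intro: antisym)
qed

lemma constant_solution_sum:
  assumes w: "constant_solution (lam_of_deficit r) w" and r: "0 < r" "r < 1"
  shows "lam_of_deficit r * (w $ 1 + w $ 2) = - (F1 (d - r) + F2 (d - r))"
  using w unfolding constant_solution_iff constant_solution_gap[OF assms]
  by (simp add: distrib_left)

lemma balance_pos: "g > 0 \<Longrightarrow> balance g > 0"
  using d_gt_1 gam_bounds by (auto simp: balance_def intro!: divide_pos_pos mult_pos_pos)

text \<open>Write S for the sum and r for \<open>balance g\<close>. The duality gap gives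
  \<open>lam\<close> S \<ge> d g, while \<open>lam\<close> \<le> 2 \<gamma> r / (d - r) and r is at
  most a multiple of g. The factor g cancels, leaving a bound on S that survives as g tends to
  0.\<close>

lemma constant_solution_sum_no_saddle:
  fixes k :: nat
  defines "g \<equiv> (1 / 4) ^ k / 2"
  assumes w: "constant_solution (lam_of_deficit (balance g)) w" and r: "balance g < 1"
  shows "d * (2 * \<gamma> - 1) / (2 * \<gamma> * (1 + d)\<^sup>2) * (d - balance g) \<le> w $ 1 + w $ 2"
proof -
  let ?r = "balance g" and ?lam = "lam_of_deficit (balance g)" and ?S = "w $ 1 + w $ 2"
  have g: "g > 0"
    by (simp add: g_def)
  note r0 = balance_pos[OF g]
  have s: "d - ?r > 0"
    using r d_gt_1 by simp
  have "F1 (d - ?r) + F2 (d - ?r) \<le> - (d * g)"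
    using g r by (intro F_sum_no_saddle) (auto simp: g_def dest!: offsets_separated[of _ k])
  then have dg: "d * g \<le> ?lam * ?S"
    using constant_solution_sum[OF w r0 r] by simp
  moreover have "0 < d * g"
    using d_gt_1 g by simp
  ultimately have "0 < ?lam * ?S"
    by linarith
  \<comment> \<open>The sign of S allows the upper bound on \<open>lam\<close> to be multiplied by
    S.\<close>
  then have S: "?S \<ge> 0"
    using lam_of_deficit_bounds(1)[OF r0 r] by (simp add: zero_less_mult_iff)
  have "?lam * ?S \<le> 2 * \<gamma> * ?r / (d - ?r) * ?S"
    using lam_of_deficit_bounds(2)[OF r0 r] S by (rule mult_right_mono)
  with dg have "d * g \<le> 2 * \<gamma> * ?r / (d - ?r) * ?S"
    by linarith
  also have "\<dots> = 2 * \<gamma> * ?S * ?r / (d - ?r)"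
    by simp
  finally have main: "d * g * (d - ?r) \<le> 2 * \<gamma> * ?S * ?r"
    by (simp only: pos_le_divide_eq[OF s])
  \<comment> \<open>This drops the term 2 g from the denominator of \<open>balance\<close>.\<close>
  have "(2 * \<gamma> - 1) * ?r \<le> (1 + d)\<^sup>2 * g"
    using g gam_bounds d_gt_1 r0 by (simp add: balance_def field_simps)
  then have "d * ((2 * \<gamma> - 1) * ?r) * (d - ?r) \<le> d * ((1 + d)\<^sup>2 * g) * (d - ?r)"
    using s d_gt_1 by (intro mult_right_mono mult_left_mono) auto
  also have "\<dots> = (1 + d)\<^sup>2 * (d * g * (d - ?r))"
    by (simp add: algebra_simps)
  also have "\<dots> \<le> (1 + d)\<^sup>2 * (2 * \<gamma> * ?S * ?r)"
    using main by (rule mult_left_mono) simp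
  finally have "?r * (d * (2 * \<gamma> - 1) * (d - ?r)) \<le> ?r * ((1 + d)\<^sup>2 * (2 * \<gamma> * ?S))"
    by (simp add: algebra_simps)
  then have "d * (2 * \<gamma> - 1) * (d - ?r) \<le> (1 + d)\<^sup>2 * (2 * \<gamma> * ?S)"
    using r0 by simp
  then show ?thesis
    using gam_bounds d_gt_1 by (simp add: field_simps)
qed

section \<open>Two sequences with incompatible limits\<close>

lemma balance_tendsto:
  assumes "g \<longlonglongrightarrow> 0"
  shows "(\<lambda>k. balance (g k)) \<longlonglongrightarrow> 0"
proof -
  have "(\<lambda>k. balance (g k)) \<longlonglongrightarrow> (1 + d)\<^sup>2 * 0 / (2 * \<gamma> - 1 + 2 * 0)"
    unfolding balance_def using gam_bounds by (intro tendsto_intros assms) auto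
  then show ?thesis by simp
qed

text \<open>This lets a limit for \<open>lam\<close> tending to 0 from the right be tested along a
  sequence of deficits.\<close>

lemma lam_of_deficit_at_right:
  assumes r: "r \<longlonglongrightarrow> 0" and pos: "\<And>k. 0 < r k"
  shows "filterlim (\<lambda>k. lam_of_deficit (r k)) (at_right 0) sequentially"
proof -
  have small: "eventually (\<lambda>k. r k < 1) sequentially"
    using r by (rule order_tendstoD) simp
  then have ev: "eventually (\<lambda>k. 0 < lam_of_deficit (r k)) sequentially"
    by eventually_elim (use lam_of_deficit_bounds(1) pos in blast)
  have "(\<lambda>k. 2 * \<gamma> * r k / (d - r k)) \<longlonglongrightarrow> 2 * \<gamma> * 0 / (d - 0)"
    using d_gt_1 by (intro tendsto_intros r) auto
  then have lim: "(\<lambda>k. 2 * \<gamma> * r k / (d - r k)) \<longlonglongrightarrow> 0"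
    by simp
  have "(\<lambda>k. lam_of_deficit (r k)) \<longlonglongrightarrow> 0"
  proof (rule tendsto_sandwich[OF _ _ tendsto_const lim])
    show "eventually (\<lambda>k. 0 \<le> lam_of_deficit (r k)) sequentially"
      using ev by eventually_elim simp
    show "eventually (\<lambda>k. lam_of_deficit (r k) \<le> 2 * \<gamma> * r k / (d - r k)) sequentially"
      using small by eventually_elim (use lam_of_deficit_bounds(2) pos in blast)
  qed
  with ev show "filterlim (\<lambda>k. lam_of_deficit (r k)) (at_right 0) sequentially"
    by (auto simp: filterlim_at elim: eventually_mono)
qed

lemma constant_solutions_diverge:
  assumes a: "\<And>lam. lam > 0 \<Longrightarrow> constant_solution lam (a lam)"
  shows "\<not> (a \<longlongrightarrow> l) (at_right 0)"
proof
  assume l: "(a \<longlongrightarrow> l) (at_right 0)"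
  have pow: "(\<lambda>k. (1 / 4 :: real) ^ k) \<longlonglongrightarrow> 0"
    by (simp add: LIMSEQ_power_zero)
  have sum_lim: "(\<lambda>k. a (lam_of_deficit (r k)) $ 1 + a (lam_of_deficit (r k)) $ 2) \<longlonglongrightarrow> l $ 1 + l $ 2"
    if "r \<longlonglongrightarrow> 0" "\<And>k. 0 < r k" for r
    using filterlim_compose[OF l lam_of_deficit_at_right[OF that]]
    by (intro tendsto_add tendsto_vec_nth)
  \<comment> \<open>The lines now cross at \<open>(1 / 4) ^ k\<close>, an available offset once k
    \<ge> K, so the sum of the components is eventually 0.\<close>
  define r where "r k = balance ((1 / 4) ^ k)" for k
  have r: "r \<longlonglongrightarrow> 0" "\<And>k. 0 < r k"
    using balance_tendsto[OF pow] by (auto simp: r_def[abs_def] intro: balance_pos)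
  have "eventually (\<lambda>k. r k < 1) sequentially"
    using r(1) by (rule order_tendstoD) simp
  then have "eventually (\<lambda>k. a (lam_of_deficit (r k)) $ 1 + a (lam_of_deficit (r k)) $ 2 = 0) sequentially"
    using eventually_ge_at_top[of K]
  proof eventually_elim
    case (elim k)
    have "F1 (d - r k) + F2 (d - r k) = 0"
      using elim unfolding r_def by (intro F_sum_saddle) (auto simp: offsets_def)
    then show ?case
      using constant_solution_sum[OF a r(2) elim(1)] lam_of_deficit_bounds(1)[OF r(2) elim(1)]
      by simp
  qed
  then have zero: "l $ 1 + l $ 2 = 0"
    by (rule LIMSEQ_unique[OF sum_lim[OF r] tendsto_eventually])
  \<comment> \<open>Here the crossing point is half a power of 1/4, the case with a duality
    gap.\<close>
  define q where "q k = balance ((1 / 4) ^ k / 2)" for k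
  have q: "q \<longlonglongrightarrow> 0" "\<And>k. 0 < q k"
    using balance_tendsto[OF tendsto_divide_zero[OF pow]] by (auto simp: q_def[abs_def] intro: balance_pos)
  let ?c = "d * (2 * \<gamma> - 1) / (2 * \<gamma> * (1 + d)\<^sup>2)"
  have "eventually (\<lambda>k. q k < 1) sequentially"
    using q(1) by (rule order_tendstoD) simp
  then have "eventually (\<lambda>k. ?c * (d - q k)
      \<le> a (lam_of_deficit (q k)) $ 1 + a (lam_of_deficit (q k)) $ 2) sequentially"
  proof eventually_elim
    case (elim k)
    show ?case
      using constant_solution_sum_no_saddle[of k] a lam_of_deficit_bounds(1)[OF q(2) elim] elim
      unfolding q_def by blast
  qed
  moreover have "(\<lambda>k. ?c * (d - q k)) \<longlonglongrightarrow> ?c * (d - 0)"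
    by (intro tendsto_intros q)
  ultimately have "?c * (d - 0) \<le> l $ 1 + l $ 2"
    using tendsto_le[OF _ sum_lim[OF q]] by simp
  \<comment> \<open>Positivity comes from \<gamma> > 1/2, which is d > 1.\<close>
  moreover have "?c * (d - 0) > 0"
    using d_gt_1 gam_bounds by simp
  ultimately show False
    using zero by simp
qed

section \<open>Viscosity solutions are constant\<close>

lemma viscosity_solution_constant:
  fixes u :: "real ^ 'n \<Rightarrow> real ^ 2"
  assumes u: "viscosity_solution lam H (coupling d K) u" and lam: "lam > 0"
    and H: "\<And>i. H i 0 = 0"
  shows "u x = u 0" and "constant_solution lam (u 0)"
proof -
  have "periodic u" "continuous_on UNIV u"
    using u by (auto simp: viscosity_solution_def)
  then have pc: "periodic (\<lambda>x. u x $ i)" "continuous_on UNIV (\<lambda>x. u x $ i)" for i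
    by (simp_all add: periodic_def continuous_on_component)
  \<comment> \<open>The zero test function touches each component at its extrema; its gradient is 0,
    where H vanishes.\<close>
  have C1: "C1_torus (\<lambda>_. 0) (\<lambda>_ :: real ^ 'n. 0)"
    by (simp add: C1_torus_def periodic_def gderiv_def)
  have test: "((\<forall>y. u y $ i - 0 \<le> u x $ i - 0) \<longrightarrow> lam * u x $ i + H i 0 + coupling d K i (u x) \<le> 0) \<and>
      ((\<forall>y. u y $ i - 0 \<ge> u x $ i - 0) \<longrightarrow> lam * u x $ i + H i 0 + coupling d K i (u x) \<ge> 0)" for i x
    using u[unfolded viscosity_solution_def, THEN conjunct2, THEN conjunct2,
        THEN spec, THEN spec, THEN spec, THEN spec, THEN mp, OF C1] .
  have sub: "lam * u x $ i + coupling d K i (u x) \<le> 0" if "\<And>y. u y $ i \<le> u x $ i" for i x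
    using test[of i x] that by (simp add: H)
  have super: "lam * u x $ i + coupling d K i (u x) \<ge> 0" if "\<And>y. u x $ i \<le> u y $ i" for i x
    using test[of i x] that by (simp add: H)
  have "\<exists>x. \<forall>y. u y $ i \<le> u x $ i" for i
    using periodic_attains_sup[OF pc(1)[of i] pc(2)[of i]] by blast
  then obtain X where X: "\<And>i y. u y $ i \<le> u (X i) $ i"
    by metis
  have "\<exists>x. \<forall>y. u x $ i \<le> u y $ i" for i
    using periodic_attains_inf[OF pc(1)[of i] pc(2)[of i]] by blast
  then obtain Y where Y: "\<And>i y. u (Y i) $ i \<le> u y $ i"
    by metis
  define M where "M i = u (X i) $ i" for i
  define m where "m i = u (Y i) $ i" for i
  have M: "u y $ i \<le> M i" and m: "m i \<le> u y $ i" for y i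
    using X Y by (auto simp: M_def m_def)
  have mM: "m i \<le> M i" for i
    using m M order_trans by blast
  \<comment> \<open>At a maximum point of the first component the second is at most
    \<open>M 2\<close>, so the gap there is at least \<open>M 1 - M 2\<close> and monotonicity of
    \<open>F1\<close> applies. The next three bounds are analogous.\<close>
  have M1: "lam * M 1 + F1 (M 1 - M 2) \<le> 0"
    using sub[OF X, of 1] F1_mono[of "M 1 - M 2" "M 1 - u (X 1) $ 2"] M[of "X 1" 2]
    by (simp add: coupling_eq_gap_coupling[of d K _ "u _"] M_def)
  have M2: "lam * M 2 + F2 (M 1 - M 2) \<le> 0"
    using sub[OF X, of 2] F2_antimono[of "u (X 2) $ 1 - M 2" "M 1 - M 2"] M[of "X 2" 1]
    by (simp add: coupling_eq_gap_coupling[of d K _ "u _"] M_def)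
  have m1: "lam * m 1 + F1 (m 1 - m 2) \<ge> 0"
    using super[OF Y, of 1] F1_mono[of "m 1 - u (Y 1) $ 2" "m 1 - m 2"] m[of 2 "Y 1"]
    by (simp add: coupling_eq_gap_coupling[of d K _ "u _"] m_def)
  have m2: "lam * m 2 + F2 (m 1 - m 2) \<ge> 0"
    using super[OF Y, of 2] F2_antimono[of "m 1 - m 2" "u (Y 2) $ 1 - m 2"] m[of 1 "Y 2"]
    by (simp add: coupling_eq_gap_coupling[of d K _ "u _"] m_def)
  \<comment> \<open>The order of the two gaps decides which component to compare first. Once its
    maximum and minimum agree, the case assumption itself bounds the other maximum by the other
    minimum.\<close>
  have "M 1 = m 1 \<and> M 2 = m 2"
  proof (cases "m 1 - m 2 \<le> M 1 - M 2")
    case True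
    then have "lam * M 1 \<le> lam * m 1"
      using F1_mono[OF True] M1 m1 by simp
    then have "M 1 \<le> m 1"
      using lam by simp
    with True mM[of 1] mM[of 2] show ?thesis by simp
  next
    case False
    then have "lam * M 2 \<le> lam * m 2"
      using F2_antimono[of "M 1 - M 2" "m 1 - m 2"] M2 m2 by simp
    then have "M 2 \<le> m 2"
      using lam by simp
    with False mM[of 1] mM[of 2] show ?thesis by simp
  qed
  then have Mm: "M i = m i" for i
    using exhaust_2[of i] by auto
  have const: "u y $ i = M i" for y i
    using M[of y i] m[of i y] Mm[of i] by simp
  then show "u x = u 0"
    by (simp add: vec_eq_iff)
  \<comment> \<open>For a constant function the point 0 is both a maximum and a minimum point, so
    both inequalities hold there.\<close>
  have "lam * u 0 $ i + coupling d K i (u 0) = 0" for i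
    by (intro antisym sub super) (simp_all add: const)
  then show "constant_solution lam (u 0)"
    by (simp add: constant_solution_def)
qed

end

theorem theorem3:
  fixes d :: real and K :: nat
    and H :: "2 \<Rightarrow> real ^ 'n \<Rightarrow> real"
    and u :: "real \<Rightarrow> real ^ 'n \<Rightarrow> real ^ 2"
  assumes "d > 1" and "K > 0" and "gam d + (1 / 4) ^ K < 1"
    and "\<And>i. continuous_on UNIV (H i)" and "\<And>i. H i 0 = 0"
    and "\<And>lam. lam > 0 \<Longrightarrow> viscosity_solution lam H (coupling d K) (u lam)"
  shows "\<exists>a :: real \<Rightarrow> real ^ 2.
           (\<forall>lam>0. \<forall>x. u lam x = a lam) \<and>
           bounded (a ` {0<..}) \<and>
           \<not> (\<exists>l. (a \<longlongrightarrow> l) (at_right 0))"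
proof -
  interpret game d K
    using assms(1,3) by unfold_locales
  have sol: "constant_solution lam (u lam 0)" if "lam > 0" for lam
    using viscosity_solution_constant(2)[OF assms(6)[OF that] that assms(5)] .
  have "u lam x = u lam 0" if "lam > 0" for lam x
    using viscosity_solution_constant(1)[OF assms(6)[OF that] that assms(5)] .
  moreover have "bounded ((\<lambda>lam. u lam 0) ` {0<..})"
    by (rule boundedI[of _ "2 * d"]) (auto intro!: constant_solution_bounds sol)
  moreover have "\<not> (\<exists>l. ((\<lambda>lam. u lam 0) \<longlongrightarrow> l) (at_right 0))"
    using constant_solutions_diverge[of "\<lambda>lam. u lam 0", OF sol] by simp
  ultimately have "(\<forall>lam>0. \<forall>x. u lam x = u lam 0) \<and> bounded ((\<lambda>lam. u lam 0) ` {0<..}) \<and>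
      \<not> (\<exists>l. ((\<lambda>lam. u lam 0) \<longlongrightarrow> l) (at_right 0))"
    by blast
  then show ?thesis
    by (rule exI[of _ "\<lambda>lam. u lam 0"])
qed

end
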